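(* Let $A=A^*$ be an invertible Hermitian $N\times N$ matrix, let $m$ be an integer with $1\le m\le N$, and let $\epsilon>0$. For $K>0$ consider the following two assertions: (I) $C_\epsilon(A)\ge m$; (II)$_K$ there exist index subsets $\alpha_m=\{i_1,\ldots,i_m\}$ and $\beta_m=\{j_1,\ldots,j_m\}$ of $\{1,\ldots,N\}$ (each of cardinality $m$) such that $$A^{-1}[\alpha_m,\beta_m]\,A^{-1}[\beta_m,\alpha_m]\;>\;\frac{K^2}{\epsilon^2}\,I_N[\alpha_m,\alpha_m].$$ Then (I) implies (II)$_K$ with $K=\dfrac{C_m}{N}$, where $C_m=\dfrac{1}{m!\,2^{m-1}}$. Conversely, (II)$_K$ with $K=1$ implies (I).
   Context: $C_\epsilon(A)$ denotes the number of eigenvalues, counted with multiplicity, of the Hermitian matrix $A$ in the open interval $(-\epsilon,\epsilon)$. For an $N\times N$ matrix $M$ and index subsets $\alpha,\beta\subset\{1,\ldots,N\}$, $M[\alpha,\beta]$ is the submatrix of $M$ with rows indexed by $\alpha$ and columns indexed by $\beta$ (in increasing order); $A^{-1}[\alpha,\beta]$ means $(A^{-1})[\alpha,\beta]$. $I_N$ is the $N\times N$ identity matrix. For Hermitian matrices, $X>Y$ means that $X-Y$ is positive definite. *)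

theory Defs
  imports
    Jordan_Normal_Form.Schur_Decomposition
    Jordan_Normal_Form.Gauss_Jordan_Elimination
    Jordan_Normal_Form.DL_Submatrix
begin

definition hermitian_mat :: "complex mat \<Rightarrow> bool" where
  "hermitian_mat A \<longleftrightarrow> square_mat A \<and> mat_adjoint A = A"

text \<open>The eigenvalues of a Hermitian matrix are real, so it suffices to range over the real
  points of the open interval. The multiplicity is that of a root of the characteristic
  polynomial, which for a Hermitian matrix is also the dimension of the eigenspace.\<close>
definition eig_count :: "real \<Rightarrow> complex mat \<Rightarrow> nat" where
  "eig_count \<epsilon> A =
     (\<Sum>x | x \<in> {-\<epsilon><..<\<epsilon>} \<and> eigenvalue A (complex_of_real x).
        Polynomial.order (complex_of_real x) (char_poly A))"

text \<open>Only meaningful for invertible square matrices, where \<^const>\<open>mat_inverse\<close> is not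
  \<^const>\<open>None\<close>.\<close>
definition mat_inv :: "complex mat \<Rightarrow> complex mat" where
  "mat_inv A = the (mat_inverse A)"

text \<open>Since \<open>u \<bullet>c w\<close> conjugates its second argument, \<open>(M *\<^sub>v v) \<bullet>c v\<close> is the form
  \<open>v\<^sup>* M v\<close>. It is real when \<open>M\<close> is Hermitian.\<close>
definition positive_definite :: "complex mat \<Rightarrow> bool" where
  "positive_definite M \<longleftrightarrow> hermitian_mat M \<and>
     (\<forall>v \<in> carrier_vec (dim_row M). v \<noteq> 0\<^sub>v (dim_row M) \<longrightarrow> Re ((M *\<^sub>v v) \<bullet>c v) > 0)"

definition hermitian_greater :: "complex mat \<Rightarrow> complex mat \<Rightarrow> bool" where
  "hermitian_greater X Y \<longleftrightarrow> hermitian_mat X \<and> hermitian_mat Y \<and> dim_row X = dim_row Y \<and>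
     positive_definite (X - Y)"

text \<open>Matrices are indexed from 0, so the index set is \<open>{..<N}\<close>.\<close>
definition large_inverse_block :: "nat \<Rightarrow> nat \<Rightarrow> real \<Rightarrow> real \<Rightarrow> complex mat \<Rightarrow> bool" where
  "large_inverse_block N m \<epsilon> K A \<longleftrightarrow>
     (\<exists>\<alpha> \<beta>. \<alpha> \<subseteq> {..<N} \<and> \<beta> \<subseteq> {..<N} \<and> card \<alpha> = m \<and> card \<beta> = m \<and>
        hermitian_greater
          (submatrix (mat_inv A) \<alpha> \<beta> * submatrix (mat_inv A) \<beta> \<alpha>)
          (complex_of_real (K\<^sup>2 / \<epsilon>\<^sup>2) \<cdot>\<^sub>m submatrix (1\<^sub>m N) \<alpha> \<alpha>))"

definition block_const :: "nat \<Rightarrow> real" where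
  "block_const m = 1 / (fact m * 2 ^ (m - 1))"

end

theory Submission
  imports Defs "HOL-Analysis.L2_Norm"
begin

text \<open>Put \<open>B = A\<^sup>-\<^sup>1\<close>. The eigenvalues of \<open>A\<close> in \<open>(-\<epsilon>, \<epsilon>)\<close> are the inverses of those of \<open>B\<close> of
  modulus above \<open>1/\<epsilon>\<close>, and the matrix inequality says that the least singular value of
  \<open>B[\<beta>, \<alpha>]\<close> exceeds \<open>K/\<epsilon>\<close>.

  If there are \<open>m\<close> such eigenvalues, let \<open>V\<close> have orthonormal eigenvectors as its \<open>m\<close>
  columns, and choose the rows \<open>\<alpha>\<close> of \<open>V\<close> with the largest \<open>m \<times> m\<close> determinant. By Cramer's
  rule all rows of \<open>V\<close> are combinations of the chosen ones with coefficients of modulus at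
  most \<open>1\<close>, so restricting to them costs at most a factor \<open>sqrt (m N)\<close> in the least singular
  value. Hence \<open>B\<close> expands every vector supported on \<open>\<alpha>\<close> by more than \<open>1 / (\<epsilon> sqrt (m N))\<close>.
  Choosing \<open>m\<close> rows \<open>\<beta>\<close> of \<open>B[_, \<alpha>]\<close> in the same way costs the same factor again, and the
  resulting constant \<open>1 / (m N)\<close> is at least \<open>C\<^sub>m / N\<close>.

  Conversely, with fewer than \<open>m\<close> such eigenvalues, some nonzero vector \<open>x\<close> supported on \<open>\<alpha>\<close>
  has \<open>B x\<close> orthogonal to their eigenvectors, so that \<open>B\<close> expands \<open>x\<close> by at most \<open>1/\<epsilon>\<close>.\<close>

subsection \<open>Adjoints and norms\<close>

lemma dim_mat_adjoint [simp]:
  "dim_row (mat_adjoint A) = dim_col A" "dim_col (mat_adjoint A) = dim_row A"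
  unfolding mat_adjoint_def by auto

lemma mat_adjoint_carrier [simp]:
  "A \<in> carrier_mat m n \<Longrightarrow> mat_adjoint A \<in> carrier_mat n m"
  by (rule carrier_matI) auto

lemma index_mat_adjoint [simp]:
  assumes "i < dim_col A" "j < dim_row A"
  shows "mat_adjoint A $$ (i, j) = conjugate (A $$ (j, i))"
  using assms unfolding mat_adjoint_def by (simp add: mat_of_rows_index)

lemma mat_adjoint_adjoint [simp]: "mat_adjoint (mat_adjoint A) = A"
  by (rule eq_matI) auto

lemma mat_adjoint_mult:
  fixes A :: "complex mat"
  assumes "A \<in> carrier_mat m n" "B \<in> carrier_mat n k"
  shows "mat_adjoint (A * B) = mat_adjoint B * mat_adjoint A"
  using assms
  by (intro eq_matI) (auto simp: scalar_prod_def mult.commute intro!: sum.cong)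

lemma mat_adjoint_one [simp]: "mat_adjoint (1\<^sub>m n :: complex mat) = 1\<^sub>m n"
  by (rule eq_matI) auto

lemma cscalar_prod_adjoint:
  fixes M :: "complex mat"
  assumes M: "M \<in> carrier_mat m n" and x: "x \<in> carrier_vec n" and y: "y \<in> carrier_vec m"
  shows "(M *\<^sub>v x) \<bullet>c y = x \<bullet>c (mat_adjoint M *\<^sub>v y)"
proof -
  have "(M *\<^sub>v x) \<bullet>c y = (\<Sum>i<m. \<Sum>j<n. M $$ (i,j) * x $ j * cnj (y $ i))"
    using assms by (simp add: scalar_prod_def sum_distrib_right lessThan_atLeast0)
  also have "\<dots> = (\<Sum>j<n. \<Sum>i<m. M $$ (i,j) * x $ j * cnj (y $ i))"
    by (rule sum.swap)
  also have "\<dots> = x \<bullet>c (mat_adjoint M *\<^sub>v y)"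
    using assms
    by (simp add: scalar_prod_def sum_distrib_left lessThan_atLeast0 mult_ac)
  finally show ?thesis .
qed

text \<open>Kept squared and real: every estimate below compares sums of squares, and roots would
  only have to be removed again.\<close>

definition vec_norm2 :: "complex vec \<Rightarrow> real" where
  "vec_norm2 v = (\<Sum>i<dim_vec v. (cmod (v $ i))\<^sup>2)"

lemma cscalar_prod_self: "v \<bullet>c v = complex_of_real (vec_norm2 v)"
  unfolding vec_norm2_def scalar_prod_def
  by (simp add: lessThan_atLeast0 complex_norm_square flip: of_real_power)

lemma vec_norm2_nonneg [simp]: "0 \<le> vec_norm2 v"
  unfolding vec_norm2_def by (simp add: sum_nonneg)

lemma vec_norm2_pos:
  assumes "v \<in> carrier_vec n" "v \<noteq> 0\<^sub>v n"
  shows "0 < vec_norm2 v"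
  using assms conjugate_square_eq_0_vec[of v n] vec_norm2_nonneg[of v]
  by (auto simp: cscalar_prod_self less_le)

lemma vec_norm2_zero [simp]: "vec_norm2 (0\<^sub>v n) = 0"
  unfolding vec_norm2_def by simp

text \<open>Cauchy-Schwarz, reduced to the real inequality for moduli by the triangle inequality.
  Without a conjugate it fits the bilinear sums in \<open>dominant_rows\<close>; with
  \<open>b\<close> conjugated it gives the Hermitian version.\<close>

lemma norm_sum_mult_le:
  fixes a b :: "'i \<Rightarrow> complex"
  shows "(cmod (\<Sum>i\<in>S. a i * b i))\<^sup>2 \<le> (\<Sum>i\<in>S. (cmod (a i))\<^sup>2) * (\<Sum>i\<in>S. (cmod (b i))\<^sup>2)"
proof -
  have "cmod (\<Sum>i\<in>S. a i * b i) \<le> (\<Sum>i\<in>S. \<bar>cmod (a i)\<bar> * \<bar>cmod (b i)\<bar>)"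
    by (rule order.trans[OF norm_sum]) (simp add: norm_mult)
  also have "\<dots> \<le> L2_set (\<lambda>i. cmod (a i)) S * L2_set (\<lambda>i. cmod (b i)) S"
    by (rule L2_set_mult_ineq)
  finally have "(cmod (\<Sum>i\<in>S. a i * b i))\<^sup>2
      \<le> (L2_set (\<lambda>i. cmod (a i)) S * L2_set (\<lambda>i. cmod (b i)) S)\<^sup>2"
    by (rule power_mono) simp
  then show ?thesis
    by (simp add: power_mult_distrib L2_set_def sum_nonneg)
qed

lemma cscalar_prod_norm_le:
  assumes "v \<in> carrier_vec n" "w \<in> carrier_vec n"
  shows "(cmod (v \<bullet>c w))\<^sup>2 \<le> vec_norm2 v * vec_norm2 w"
  using assms norm_sum_mult_le[of "\<lambda>i. v $ i" "\<lambda>i. cnj (w $ i)" "{..<n}"]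
  unfolding scalar_prod_def vec_norm2_def by (simp add: lessThan_atLeast0)

text \<open>The matrix may be rectangular, so this covers unitary matrices as well as selection
  matrices.\<close>

lemma vec_norm2_isometry:
  assumes U: "U \<in> carrier_mat m n" and UU: "mat_adjoint U * U = 1\<^sub>m n" and v: "v \<in> carrier_vec n"
  shows "vec_norm2 (U *\<^sub>v v) = vec_norm2 v"
proof -
  have "(U *\<^sub>v v) \<bullet>c (U *\<^sub>v v) = v \<bullet>c ((mat_adjoint U * U) *\<^sub>v v)"
    using cscalar_prod_adjoint[OF U v, of "U *\<^sub>v v"] U v
    by (simp add: assoc_mult_mat_vec[of _ n m _ n])
  then show ?thesis using v by (simp add: UU cscalar_prod_self)
qed

lemma nonzero_det_inverse:
  fixes M :: "complex mat"
  assumes "M \<in> carrier_mat n n" "det M \<noteq> 0"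
  obtains L where "L \<in> carrier_mat n n" "M * L = 1\<^sub>m n" "L * M = 1\<^sub>m n"
  using det_non_zero_imp_unit[OF assms, of undefined]
  unfolding Units_def by (auto simp: ring_mat_def)

text \<open>For a square matrix, \<open>M\<close> and \<open>M\<^sup>*\<close> have the same least singular value.\<close>

lemma adjoint_lower_bound:
  assumes M: "M \<in> carrier_mat n n" and c: "c > 0"
    and lower: "\<And>w. w \<in> carrier_vec n \<Longrightarrow> c * vec_norm2 w \<le> vec_norm2 (M *\<^sub>v w)"
    and y: "y \<in> carrier_vec n"
  shows "c * vec_norm2 y \<le> vec_norm2 (mat_adjoint M *\<^sub>v y)"
proof (cases "y = 0\<^sub>v n")
  case True
  then show ?thesis by simp
next
  case False
  then have pos: "0 < vec_norm2 y" using y by (rule vec_norm2_pos[rotated])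
  have "det M \<noteq> 0"
  proof
    assume "det M = 0"
    then obtain v where v: "v \<in> carrier_vec n" "v \<noteq> 0\<^sub>v n" "M *\<^sub>v v = 0\<^sub>v n"
      using det_0_iff_vec_prod_zero[OF M] by auto
    then show False using lower[OF v(1)] vec_norm2_pos[OF v(1,2)] c
      by (simp add: mult_le_0_iff)
  qed
  then obtain L where L: "L \<in> carrier_mat n n" "M * L = 1\<^sub>m n"
    using nonzero_det_inverse[OF M] by metis
  \<comment> \<open>Pulling \<open>y\<close> back along \<open>M\<close> writes its squared norm as
    the product of \<open>w\<close> with \<open>mat_adjoint M *\<^sub>v y\<close>. Cauchy-Schwarz
    and the bound \<open>lower\<close> for \<open>w\<close> then give the claim after one factor
    \<open>vec_norm2 y\<close> is cancelled.\<close>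
  define w where "w = L *\<^sub>v y"
  have w: "w \<in> carrier_vec n" and Mw: "M *\<^sub>v w = y"
    using L M y by (auto simp: w_def assoc_mult_mat_vec[symmetric, of _ n n _ n])
  have "complex_of_real (vec_norm2 y) = w \<bullet>c (mat_adjoint M *\<^sub>v y)"
    using cscalar_prod_adjoint[OF M w y] Mw by (simp add: cscalar_prod_self)
  then have "(vec_norm2 y)\<^sup>2 = (cmod (w \<bullet>c (mat_adjoint M *\<^sub>v y)))\<^sup>2"
    by (metis norm_of_real power2_abs)
  also have "\<dots> \<le> vec_norm2 w * vec_norm2 (mat_adjoint M *\<^sub>v y)"
    by (rule cscalar_prod_norm_le[OF w mult_mat_vec_carrier[OF mat_adjoint_carrier[OF M] y]])
  finally have "c * (vec_norm2 y)\<^sup>2 \<le> c * vec_norm2 w * vec_norm2 (mat_adjoint M *\<^sub>v y)"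
    using c by (simp add: mult.assoc)
  also have "\<dots> \<le> vec_norm2 y * vec_norm2 (mat_adjoint M *\<^sub>v y)"
    using lower[OF w] Mw by (intro mult_right_mono) auto
  finally show ?thesis using pos by (simp add: power2_eq_square mult_ac)
qed

subsection \<open>Dominant row sets\<close>

text \<open>A weak form of Cauchy-Binet. The Gram determinant is nonzero by injectivity, and
  multilinearity in the rows expands it into a sum whose terms each contain a minor of
  \<open>G\<close> as a factor, so some minor survives.\<close>

lemma exists_nonzero_minor:
  fixes G :: "complex mat"
  assumes G: "G \<in> carrier_mat n m"
    and inj: "\<And>w. w \<in> carrier_vec m \<Longrightarrow> w \<noteq> 0\<^sub>v m \<Longrightarrow> G *\<^sub>v w \<noteq> 0\<^sub>v n"
  obtains f where "\<forall>i\<in>{0..<m}. f i \<in> {0..<n}" "\<forall>i. i \<notin> {0..<m} \<longrightarrow> f i = i"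
    "det (mat m m (\<lambda>(i, j). G $$ (f i, j))) \<noteq> 0"
proof -
  define H where "H = mat_adjoint G * G"
  have H: "H \<in> carrier_mat m m" using G by (auto simp: H_def)
  have "det H \<noteq> 0"
  proof
    assume "det H = 0"
    then obtain w where w: "w \<in> carrier_vec m" "w \<noteq> 0\<^sub>v m" "H *\<^sub>v w = 0\<^sub>v m"
      using det_0_iff_vec_prod_zero[OF H] by auto
    have "(G *\<^sub>v w) \<bullet>c (G *\<^sub>v w) = w \<bullet>c (H *\<^sub>v w)"
      using cscalar_prod_adjoint[OF G w(1), of "G *\<^sub>v w"] G w(1)
      by (simp add: H_def assoc_mult_mat_vec[of _ m n _ m])
    also have "\<dots> = 0" using w by simp
    finally show False
      using inj[OF w(1,2)] G w(1) conjugate_square_eq_0_vec[of "G *\<^sub>v w" n] by auto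
  qed
  \<comment> \<open>Row \<open>i\<close> of the Gram matrix is the sum over \<open>j\<close> of
    \<open>a i j\<close>, a multiple of row \<open>j\<close> of \<open>G\<close>; this is the shape
    that \<open>det_linear_rows_sum\<close> expands.\<close>
  define a where "a = (\<lambda>i j. cnj (G $$ (j, i)) \<cdot>\<^sub>v row G j)"
  have a: "a \<in> {0..<m} \<rightarrow> {0..<n} \<rightarrow> carrier_vec m"
    using G by (auto simp: a_def)
  have "H = mat\<^sub>r m m (\<lambda>i. finsum_vec TYPE(complex) m (a i) {0..<n})"
  proof (rule eq_matI)
    fix i j assume "i < dim_row (mat\<^sub>r m m (\<lambda>i. finsum_vec TYPE(complex) m (a i) {0..<n}))"
      "j < dim_col (mat\<^sub>r m m (\<lambda>i. finsum_vec TYPE(complex) m (a i) {0..<n}))"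
    then have ij: "i < m" "j < m" by auto
    have "finsum_vec TYPE(complex) m (a i) {0..<n} $ j = (\<Sum>k\<in>{0..<n}. a i k $ j)"
      by (rule index_finsum_vec) (use ij G in \<open>auto simp: a_def\<close>)
    then show "H $$ (i, j) = mat\<^sub>r m m (\<lambda>i. finsum_vec TYPE(complex) m (a i) {0..<n}) $$ (i, j)"
      using ij G by (simp add: H_def scalar_prod_def a_def)
  qed (use H in auto)
  with det_linear_rows_sum[OF _ a]
  have "(\<Sum>f | (\<forall>i\<in>{0..<m}. f i \<in> {0..<n}) \<and> (\<forall>i. i \<notin> {0..<m} \<longrightarrow> f i = i).
      det (mat\<^sub>r m m (\<lambda>i. a i (f i)))) \<noteq> 0"
    using \<open>det H \<noteq> 0\<close> by simp
  then obtain f where "f \<in> {f. (\<forall>i\<in>{0..<m}. f i \<in> {0..<n}) \<and> (\<forall>i. i \<notin> {0..<m} \<longrightarrow> f i = i)}"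
    and f3: "det (mat\<^sub>r m m (\<lambda>i. a i (f i))) \<noteq> 0"
    by (rule sum.not_neutral_contains_not_neutral)
  then have f: "\<forall>i\<in>{0..<m}. f i \<in> {0..<n}" "\<forall>i. i \<notin> {0..<m} \<longrightarrow> f i = i"
    by blast+
  have "det (mat\<^sub>r m m (\<lambda>i. a i (f i)))
      = (\<Prod>i\<in>{0..<m}. cnj (G $$ (f i, i))) * det (mat\<^sub>r m m (\<lambda>i. row G (f i)))"
    unfolding a_def by (rule det_rows_mul) (use G in auto)
  with f3 have "det (mat\<^sub>r m m (\<lambda>i. row G (f i))) \<noteq> 0" by auto
  also have "mat\<^sub>r m m (\<lambda>i. row G (f i)) = mat m m (\<lambda>(i, j). G $$ (f i, j))"
    by (rule eq_matI) (use f G in auto)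
  finally show ?thesis using f that by blast
qed

text \<open>Choose the \<open>m\<close> rows whose determinant is largest in modulus. By Cramer's rule every
  other row is then a combination of these with coefficients of modulus at most \<open>1\<close>.\<close>

lemma dominant_rows:
  fixes G :: "complex mat"
  assumes G: "G \<in> carrier_mat n m"
    and inj: "\<And>w. w \<in> carrier_vec m \<Longrightarrow> w \<noteq> 0\<^sub>v m \<Longrightarrow> G *\<^sub>v w \<noteq> 0\<^sub>v n"
  obtains \<beta> where "\<beta> \<subseteq> {..<n}" "card \<beta> = m"
    "\<And>w. w \<in> carrier_vec m \<Longrightarrow>
      vec_norm2 (G *\<^sub>v w) \<le> real m * real n * (\<Sum>j\<in>\<beta>. (cmod ((G *\<^sub>v w) $ j))\<^sup>2)"
proof -
  define F where "F = {f. (\<forall>i\<in>{0..<m}. f i \<in> {0..<n}) \<and> (\<forall>i. i \<notin> {0..<m} \<longrightarrow> f i = i)}"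
  define R where "R = (\<lambda>f. mat m m (\<lambda>(i, j). G $$ (f i, j)))"
  have R: "R f \<in> carrier_mat m m" for f by (simp add: R_def)
  have "finite F" unfolding F_def by (rule finite_bounded_functions) auto
  obtain f0 where f0: "f0 \<in> F" "det (R f0) \<noteq> 0"
  proof (rule exists_nonzero_minor[OF G])
    fix f assume "\<forall>i\<in>{0..<m}. f i \<in> {0..<n}" "\<forall>i. i \<notin> {0..<m} \<longrightarrow> f i = i"
      "det (mat m m (\<lambda>(i, j). G $$ (f i, j))) \<noteq> 0"
    then show thesis by (intro that[of f]) (auto simp: F_def R_def)
  qed (rule inj)
  have "Max ((\<lambda>f. cmod (det (R f))) ` F) \<in> (\<lambda>f. cmod (det (R f))) ` F"
    using \<open>finite F\<close> f0(1) by (intro Max_in) auto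
  then obtain f where f: "f \<in> F" and fmax: "Max ((\<lambda>f. cmod (det (R f))) ` F) = cmod (det (R f))"
    by blast
  have max: "cmod (det (R g)) \<le> cmod (det (R f))" if "g \<in> F" for g
    unfolding fmax[symmetric] using \<open>finite F\<close> that by (intro Max_ge) auto
  have det: "det (R f) \<noteq> 0" using max[OF f0(1)] f0(2) by auto
  have fn: "f i < n" if "i < m" for i using f that by (auto simp: F_def)
  \<comment> \<open>A repeated row would make the determinant vanish; injectivity gives the row set
    exactly \<open>m\<close> elements.\<close>
  have injf: "inj_on f {..<m}"
  proof (rule inj_onI, rule ccontr)
    fix i j assume ij: "i \<in> {..<m}" "j \<in> {..<m}" "f i = f j" "i \<noteq> j"
    then have "row (R f) i = row (R f) j"
      by (intro eq_vecI) (auto simp: R_def)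
    with det_identical_rows[OF R ij(4)] ij det show False by auto
  qed
  obtain L where L: "L \<in> carrier_mat m m" "L * R f = 1\<^sub>m m"
    using nonzero_det_inverse[OF R det] by metis
  have bound: "(cmod ((G *\<^sub>v w) $ j))\<^sup>2 \<le> real m * (\<Sum>k<m. (cmod ((G *\<^sub>v w) $ f k))\<^sup>2)"
    if w: "w \<in> carrier_vec m" and j: "j < n" for w j
  proof -
    \<comment> \<open>The coefficients of row \<open>j\<close> of \<open>G\<close> with respect to
      the chosen rows.\<close>
    define x where "x = L\<^sup>T *\<^sub>v row G j"
    have x: "x \<in> carrier_vec m" using L G j by (auto simp: x_def)
    have "(R f)\<^sup>T * L\<^sup>T = 1\<^sub>m m"
      using transpose_mult[OF L(1) R, of f] L(2) by simp
    then have xeq: "(R f)\<^sup>T *\<^sub>v x = row G j"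
      unfolding x_def using L G j R
      by (subst assoc_mult_mat_vec[symmetric, of _ m m _ m]) auto
    have x1: "cmod (x $ k) \<le> 1" if k: "k < m" for k
    proof -
      \<comment> \<open>Cramer's rule: exchanging the \<open>k\<close>-th chosen row for row
        \<open>j\<close> multiplies the determinant by \<open>x $ k\<close>, and by maximality of
        \<open>f\<close> this cannot increase its modulus.\<close>
      have "replace_col (R f)\<^sup>T (row G j) k = (R (f(k := j)))\<^sup>T"
        by (rule eq_matI) (use G j k in \<open>auto simp: replace_col_def R_def\<close>)
      then have "det (R (f(k := j))) = x $ k * det (R f)"
        using cramer_lemma_mat[of "(R f)\<^sup>T" m x k] R x k
        by (simp add: xeq det_transpose[of _ m])
      moreover have "f(k := j) \<in> F" using f k j by (auto simp: F_def)
      ultimately have "cmod (x $ k) * cmod (det (R f)) \<le> 1 * cmod (det (R f))"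
        using max[of "f(k := j)"] by (simp add: norm_mult)
      then show ?thesis using det by (simp only: mult_le_cancel_right) auto
    qed
    have Gj: "G $$ (j, l) = (\<Sum>k<m. x $ k * G $$ (f k, l))" if l: "l < m" for l
    proof -
      have "G $$ (j, l) = ((R f)\<^sup>T *\<^sub>v x) $ l" using xeq G j l by simp
      also have "\<dots> = (\<Sum>k<m. x $ k * G $$ (f k, l))"
        using x l by (simp add: R_def scalar_prod_def lessThan_atLeast0 mult.commute)
      finally show ?thesis .
    qed
    have "(G *\<^sub>v w) $ j = (\<Sum>l<m. (\<Sum>k<m. x $ k * G $$ (f k, l)) * w $ l)"
      using G j w Gj by (simp add: scalar_prod_def lessThan_atLeast0)
    also have "\<dots> = (\<Sum>k<m. x $ k * (\<Sum>l<m. G $$ (f k, l) * w $ l))"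
      unfolding sum_distrib_left sum_distrib_right
      by (subst sum.swap) (simp add: mult_ac)
    also have "\<dots> = (\<Sum>k<m. x $ k * (G *\<^sub>v w) $ f k)"
      using G w fn by (simp add: scalar_prod_def lessThan_atLeast0)
    finally have "(cmod ((G *\<^sub>v w) $ j))\<^sup>2
        \<le> (\<Sum>k<m. (cmod (x $ k))\<^sup>2) * (\<Sum>k<m. (cmod ((G *\<^sub>v w) $ f k))\<^sup>2)"
      using norm_sum_mult_le by simp
    \<comment> \<open>Each of the \<open>m\<close> coefficients has modulus at most 1. Summing this
      bound over all \<open>n\<close> rows later contributes the remaining factor
      \<open>n\<close>.\<close>
    also have "\<dots> \<le> real m * (\<Sum>k<m. (cmod ((G *\<^sub>v w) $ f k))\<^sup>2)"
      using sum_bounded_above[of "{..<m}" "\<lambda>k. (cmod (x $ k))\<^sup>2" 1] x1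
      by (intro mult_right_mono) (auto simp: power_le_one sum_nonneg)
    finally show ?thesis .
  qed
  show ?thesis
  proof (rule that[of "f ` {..<m}"])
    show "f ` {..<m} \<subseteq> {..<n}" using fn by auto
    show "card (f ` {..<m}) = m" using injf by (simp add: card_image)
    fix w :: "complex vec" assume w: "w \<in> carrier_vec m"
    have "vec_norm2 (G *\<^sub>v w) = (\<Sum>j<n. (cmod ((G *\<^sub>v w) $ j))\<^sup>2)"
      using G by (simp only: vec_norm2_def dim_mult_mat_vec carrier_matD)
    also have "\<dots> \<le> (\<Sum>j<n. real m * (\<Sum>k<m. (cmod ((G *\<^sub>v w) $ f k))\<^sup>2))"
      by (rule sum_mono, rule bound[OF w]) simp
    finally show "vec_norm2 (G *\<^sub>v w)
        \<le> real m * real n * (\<Sum>j\<in>f ` {..<m}. (cmod ((G *\<^sub>v w) $ j))\<^sup>2)"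
      using injf by (simp add: sum.reindex mult_ac)
  qed
qed

subsection \<open>Diagonalization of Hermitian matrices\<close>

text \<open>Gram-Schmidt on a completion of \<open>v\<close> to a basis leaves \<open>v\<close> in
  first place. Its output is orthogonal but not normalized, so the columns are rescaled and the
  first becomes a multiple of \<open>v\<close>.\<close>

lemma exists_unitary_first_col:
  fixes v :: "complex vec"
  assumes v: "v \<in> carrier_vec n" "v \<noteq> 0\<^sub>v n"
  obtains W c where "W \<in> carrier_mat n n" "mat_adjoint W * W = 1\<^sub>m n" "col W 0 = c \<cdot>\<^sub>v v"
proof -
  interpret cof_vec_space n "TYPE(complex)" .
  define ws where "ws = gram_schmidt n (basis_completion v)"
  note b = basis_completion[OF v]
  have n: "n > 0" using v by (cases n) auto
  then obtain vs where bv: "basis_completion v = v # vs"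
    using b(6,7) by (cases "basis_completion v") auto
  from gram_schmidt_result[of "basis_completion v" ws] b
  have ws: "set ws \<subseteq> carrier_vec n" "corthogonal ws" "length ws = n"
    by (auto simp: ws_def)
  have "ws \<noteq> []" using n ws(3) by auto
  then have hd: "ws ! 0 = v"
    using gram_schmidt_hd[OF v(1), of vs] hd_conv_nth[of ws] by (simp add: ws_def bv)
  define s where "s = (\<lambda>j. complex_of_real (1 / sqrt (vec_norm2 (ws ! j))))"
  define W where "W = mat n n (\<lambda>(i, j). s j * ws ! j $ i)"
  have W: "W \<in> carrier_mat n n" by (simp add: W_def)
  have wsn: "ws ! j \<in> carrier_vec n" if "j < n" for j using ws that by auto
  have "mat_adjoint W * W = 1\<^sub>m n"
  proof (rule eq_matI)
    fix i j assume "i < dim_row (1\<^sub>m n :: complex mat)" "j < dim_col (1\<^sub>m n :: complex mat)"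
    then have ij: "i < n" "j < n" by auto
    have "(mat_adjoint W * W) $$ (i, j) = cnj (s i) * s j * (ws ! j \<bullet>c ws ! i)"
      using ij W wsn[OF ij(1)] wsn[OF ij(2)]
      by (simp add: scalar_prod_def W_def sum_distrib_left mult_ac)
    also have "\<dots> = (if i = j then 1 else 0)"
    proof (cases "i = j")
      case True
      \<comment> \<open>\<open>corthogonal\<close> also says that no vector is orthogonal to itself,
        so the scaling never divides by zero.\<close>
      have "ws ! j \<bullet>c ws ! j \<noteq> 0" using ws ij by (auto simp: corthogonal_def)
      then have "vec_norm2 (ws ! j) > 0"
        using vec_norm2_nonneg[of "ws ! j"] by (auto simp: cscalar_prod_self less_le)
      then show ?thesis using True
        by (simp add: cscalar_prod_self s_def flip: of_real_mult)
    next
      case False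
      then show ?thesis using ws ij by (auto simp: corthogonal_def)
    qed
    finally show "(mat_adjoint W * W) $$ (i, j) = 1\<^sub>m n $$ (i, j)" using ij by simp
  qed (use W in auto)
  moreover have "col W 0 = s 0 \<cdot>\<^sub>v v"
    using n v by (intro eq_vecI) (auto simp: W_def hd)
  ultimately show ?thesis using that W by blast
qed

lemma hermitian_matD:
  assumes "hermitian_mat A" "i < dim_row A" "j < dim_row A"
  shows "A $$ (i, j) = cnj (A $$ (j, i))"
  using assms index_mat_adjoint[of i A j] unfolding hermitian_mat_def by auto

lemma hermitian_mat_conjugation:
  assumes "A \<in> carrier_mat n n" "hermitian_mat A" "W \<in> carrier_mat n n"
  shows "hermitian_mat (mat_adjoint W * A * W)"
  using assms unfolding hermitian_mat_def
  by (auto simp: mat_adjoint_mult[of _ n n _ n] assoc_mult_mat[of _ n n _ n _ n])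

definition real_diag :: "nat \<Rightarrow> (nat \<Rightarrow> real) \<Rightarrow> complex mat" where
  "real_diag n d = mat n n (\<lambda>(i, j). if i = j then complex_of_real (d i) else 0)"

lemma real_diag_carrier [simp]: "real_diag n d \<in> carrier_mat n n"
  unfolding real_diag_def by simp

text \<open>Deflation: a unitary matrix whose first column is an eigenvector clears the rest of the
  first column. Being Hermitian clears the first row too, and induction handles the remaining
  block.\<close>

theorem hermitian_unitary_diagonalization:
  assumes "A \<in> carrier_mat n n" "hermitian_mat A"
  shows "\<exists>U d. U \<in> carrier_mat n n \<and> mat_adjoint U * U = 1\<^sub>m n \<and>
    mat_adjoint U * A * U = real_diag n d"
  using assms
proof (induction n arbitrary: A)
  case 0
  then have "mat_adjoint (1\<^sub>m 0) * A * 1\<^sub>m 0 = real_diag 0 (\<lambda>_. 0)"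
    by (intro eq_matI) (auto simp: real_diag_def)
  then show ?case by (intro exI[of _ "1\<^sub>m 0"] exI[of _ "\<lambda>_. 0"]) auto
next
  case (Suc n)
  let ?N = "Suc n"
  note A = Suc.prems(1)
  have "\<not> constant (poly (char_poly A))"
    using degree_monic_char_poly[OF A] by (simp add: constant_degree)
  then obtain l where "eigenvalue A l"
    using fundamental_theorem_of_algebra unfolding eigenvalue_root_char_poly[OF A] by blast
  then obtain v where v: "v \<in> carrier_vec ?N" "v \<noteq> 0\<^sub>v ?N" "A *\<^sub>v v = l \<cdot>\<^sub>v v"
    using A by (auto simp: eigenvalue_def eigenvector_def)
  obtain W c where W: "W \<in> carrier_mat ?N ?N" "mat_adjoint W * W = 1\<^sub>m ?N" "col W 0 = c \<cdot>\<^sub>v v"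
    using exists_unitary_first_col[OF v(1,2)] by metis
  note W' = mat_adjoint_carrier[OF W(1)]
  have c0: "col W 0 \<in> carrier_vec ?N" by (rule carrier_vecI) (use W(1) in simp)
  define B where "B = mat_adjoint W * A * W"
  have B: "B \<in> carrier_mat ?N ?N" using W A by (auto simp: B_def)
  have hB: "hermitian_mat B"
    unfolding B_def by (rule hermitian_mat_conjugation[OF A Suc.prems(2) W(1)])
  have eig: "A *\<^sub>v col W 0 = l \<cdot>\<^sub>v col W 0"
    using v A by (simp add: W(3) mult_mat_vec[of _ ?N ?N] smult_smult_assoc mult.commute)
  have B0: "B $$ (i, 0) = (if i = 0 then l else 0)" if i: "i < ?N" for i
  proof -
    have "col B 0 = (mat_adjoint W * A) *\<^sub>v col W 0"
      unfolding B_def by (rule col_mult2[OF mult_carrier_mat[OF W' A] W(1)]) simp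
    also have "\<dots> = mat_adjoint W *\<^sub>v (l \<cdot>\<^sub>v col W 0)"
      unfolding eig[symmetric] by (rule assoc_mult_mat_vec[OF W' A c0])
    also have "\<dots> = l \<cdot>\<^sub>v (mat_adjoint W *\<^sub>v col W 0)"
      by (rule mult_mat_vec[OF W' c0])
    also have "mat_adjoint W *\<^sub>v col W 0 = col (mat_adjoint W * W) 0"
      by (rule col_mult2[OF W' W(1), symmetric]) simp
    finally have "col B 0 $ i = (l \<cdot>\<^sub>v col (1\<^sub>m ?N) 0) $ i" by (simp only: W(2))
    then show ?thesis using i B by simp
  qed
  have B0': "B $$ (0, i) = (if i = 0 then l else 0)" if i: "i < ?N" for i
    using hermitian_matD[OF hB, of 0 i] hermitian_matD[OF hB, of 0 0] B0[OF i] B0[of 0] B i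
    by (cases "i = 0") auto
  \<comment> \<open>A diagonal entry of a Hermitian matrix is its own conjugate, so the eigenvalue
    is real.\<close>
  have "l = cnj l" using hermitian_matD[OF hB, of 0 0] B0[of 0] B by simp
  then obtain r where r: "l = complex_of_real r" by (metis Reals_cases Reals_cnj_iff)
  define C where "C = mat n n (\<lambda>(i, j). B $$ (Suc i, Suc j))"
  have C: "C \<in> carrier_mat n n" by (simp add: C_def)
  have "hermitian_mat C"
    unfolding hermitian_mat_def
  proof (intro conjI eq_matI)
    fix i j assume "i < dim_row C" "j < dim_col C"
    then have ij: "i < n" "j < n" using C by auto
    then have "B $$ (Suc i, Suc j) = cnj (B $$ (Suc j, Suc i))"
      using B by (intro hermitian_matD[OF hB]) auto
    then show "mat_adjoint C $$ (i, j) = C $$ (i, j)" using ij by (simp add: C_def)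
  qed (use C in auto)
  from Suc.IH[OF C this] obtain V d where V: "V \<in> carrier_mat n n"
    "mat_adjoint V * V = 1\<^sub>m n" "mat_adjoint V * C * V = real_diag n d" by blast
  note V' = mat_adjoint_carrier[OF V(1)]
  \<comment> \<open>Block diagonal matrices with a scalar in the corner. They multiply blockwise,
    which lifts the diagonalizing matrix \<open>V\<close> of the smaller block to
    \<open>E 1 V\<close>.\<close>
  define E where "E = (\<lambda>(a::complex) M. four_block_mat (mat 1 1 (\<lambda>_. a)) (0\<^sub>m 1 n) (0\<^sub>m n 1) M)"
  have E: "E a M \<in> carrier_mat ?N ?N" if "M \<in> carrier_mat n n" for a M
    using that four_block_carrier_mat[of "mat 1 1 (\<lambda>_. a)" 1 1 M n n] by (simp add: E_def)
  have Emult: "E a M * E b L = E (a * b) (M * L)"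
    if "M \<in> carrier_mat n n" "L \<in> carrier_mat n n" for a b M L
  proof -
    have "mat 1 1 (\<lambda>_. a) * mat 1 1 (\<lambda>_. b) = mat 1 1 (\<lambda>_. a * b)"
      by (rule eq_matI) (auto simp: scalar_prod_def)
    then show ?thesis unfolding E_def using that
      by (subst mult_four_block_mat[of _ 1 1 _ n _ n _ _ 1 _ n]) auto
  qed
  have Eadj: "mat_adjoint (E 1 V) = E 1 (mat_adjoint V)"
    using V(1) by (intro eq_matI) (auto simp: E_def)
  have Eone: "E 1 (1\<^sub>m n) = 1\<^sub>m ?N"
    by (rule eq_matI) (auto simp: E_def)
  have EB: "B = E l C"
    using B B0 B0' by (intro eq_matI) (auto simp: E_def C_def)
  define U where "U = W * E 1 V"
  have U: "U \<in> carrier_mat ?N ?N" using W E[OF V(1)] by (auto simp: U_def)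
  have adjU: "mat_adjoint U = E 1 (mat_adjoint V) * mat_adjoint W"
    unfolding U_def using mat_adjoint_mult[OF W(1) E[OF V(1)]] Eadj by simp
  note EV = E[OF V(1)] E[OF V']
  have "mat_adjoint U * U = E 1 (mat_adjoint V) * (mat_adjoint W * W) * E 1 V"
    unfolding adjU unfolding U_def using EV W(1) W'
    by (simp add: assoc_mult_mat[of _ ?N ?N _ ?N _ ?N] mult_carrier_mat[of _ ?N ?N _ ?N])
  also have "\<dots> = 1\<^sub>m ?N"
    unfolding W(2) right_mult_one_mat[OF E[OF V']] Emult[OF V' V(1)] by (simp add: V(2) Eone)
  finally have "mat_adjoint U * U = 1\<^sub>m ?N" .
  \<comment> \<open>\<open>case_nat r d\<close> puts the split-off eigenvalue at index 0 and shifts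
    the entries of the smaller block by one.\<close>
  moreover have "mat_adjoint U * A * U = real_diag ?N (case_nat r d)"
  proof -
    have "mat_adjoint U * A * U = E 1 (mat_adjoint V) * B * E 1 V"
      unfolding adjU unfolding U_def B_def using EV W(1) W' A
      by (simp add: assoc_mult_mat[of _ ?N ?N _ ?N _ ?N] mult_carrier_mat[of _ ?N ?N _ ?N])
    also have "\<dots> = E l (real_diag n d)"
      unfolding EB Emult[OF V' C] Emult[OF mult_carrier_mat[OF V' C] V(1)] V(3) by simp
    also have "\<dots> = real_diag ?N (case_nat r d)"
      by (rule eq_matI) (auto simp: E_def real_diag_def r split: nat.splits)
    finally show ?thesis .
  qed
  ultimately show ?case using U by blast
qed

section \<open>Eigenvalue counts read off the diagonal\<close>

lemma order_prod_linear:
  fixes a :: "'i \<Rightarrow> complex"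
  assumes "finite S"
  shows "Polynomial.order x (\<Prod>i\<in>S. [:- a i, 1:]) = card {i\<in>S. a i = x}"
  using assms
proof (induction S)
  case empty
  then show ?case by (simp add: order_0I)
next
  case (insert k S)
  have *: "Polynomial.order x [:- a k, 1:] = (if a k = x then 1 else 0)"
    using order_power_n_n[of x 1] by (auto intro!: order_0I)
  have **: "{i \<in> insert k S. a i = x} = (if a k = x then insert k {i\<in>S. a i = x} else {i\<in>S. a i = x})"
    by auto
  have "(\<Prod>i\<in>S. [:- a i, 1:]) \<noteq> 0" using insert by auto
  then have "[:- a k, 1:] * (\<Prod>i\<in>S. [:- a i, 1:]) \<noteq> 0" by (intro no_zero_divisors) auto
  then have "Polynomial.order x (\<Prod>i\<in>insert k S. [:- a i, 1:])
      = Polynomial.order x [:- a k, 1:] + card {i\<in>S. a i = x}"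
    by (simp only: prod.insert[OF insert.hyps] order_mult insert.IH not_False_eq_True)
  then show ?case unfolding * ** using insert.hyps by simp
qed

text \<open>By similarity the characteristic polynomial splits into factors with roots
  \<open>d i\<close>, so the multiplicity of \<open>x\<close> is the size of the fibre of
  \<open>d\<close> over \<open>x\<close>. These fibres are disjoint, and their union over the
  interval is the set counted on the right.\<close>

lemma eig_count_diagonalization:
  assumes A: "A \<in> carrier_mat n n" and U: "U \<in> carrier_mat n n" "mat_adjoint U * U = 1\<^sub>m n"
    and D: "mat_adjoint U * A * U = real_diag n d"
  shows "eig_count \<epsilon> A = card {i. i < n \<and> \<bar>d i\<bar> < \<epsilon>}"
proof -
  note U' = mat_adjoint_carrier[OF U(1)]
  have "U * mat_adjoint U = 1\<^sub>m n" by (rule mat_mult_left_right_inverse[OF U' U(1,2)])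
  then have "similar_mat (real_diag n d) A"
    unfolding similar_mat_def using A U U' D
    by (intro exI[of _ "mat_adjoint U"] exI[of _ U] similar_mat_witI[of _ _ n]) auto
  then have "char_poly A = char_poly (real_diag n d)" by (simp add: char_poly_similar)
  also have "\<dots> = (\<Prod>i<n. [:- complex_of_real (d i), 1:])"
    by (subst char_poly_upper_triangular[of _ n])
      (auto simp: real_diag_def diag_mat_def prod.distinct_set_conv_list[symmetric]
        lessThan_atLeast0 o_def intro!: arg_cong[where f = prod_list])
  finally have cp: "char_poly A = (\<Prod>i<n. [:- complex_of_real (d i), 1:])" .
  have ev: "eigenvalue A (complex_of_real x) \<longleftrightarrow> (\<exists>i<n. d i = x)" for x
    unfolding eigenvalue_root_char_poly[OF A] cp by (auto simp: poly_prod)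
  have ord: "Polynomial.order (complex_of_real x) (char_poly A) = card {i. i < n \<and> d i = x}" for x
    unfolding cp by (subst order_prod_linear) auto
  define X where "X = {x \<in> {-\<epsilon><..<\<epsilon>}. \<exists>i<n. d i = x}"
  have "X \<subseteq> d ` {..<n}" by (auto simp: X_def)
  then have "finite X" by (rule finite_subset) simp
  have "eig_count \<epsilon> A = (\<Sum>x\<in>X. card {i. i < n \<and> d i = x})"
    unfolding eig_count_def ev ord X_def ..
  also have "\<dots> = card (\<Union>x\<in>X. {i. i < n \<and> d i = x})"
    by (rule card_UN_disjoint[symmetric]) (use \<open>finite X\<close> in auto)
  also have "(\<Union>x\<in>X. {i. i < n \<and> d i = x}) = {i. i < n \<and> \<bar>d i\<bar> < \<epsilon>}"
    by (auto simp: X_def)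
  finally show ?thesis .
qed

subsection \<open>Submatrices\<close>

text \<open>An element is picked at the position given by the number of smaller elements. This gives
  surjectivity, and equal cardinalities give injectivity.\<close>

lemma pick_bij_betw:
  assumes "finite I"
  shows "bij_betw (pick I) {..<card I} I"
proof -
  have "pick I ` {..<card I} = I"
  proof
    show "pick I ` {..<card I} \<subseteq> I" using pick_in_set_le[of _ I] by auto
    show "I \<subseteq> pick I ` {..<card I}"
    proof
      fix i assume i: "i \<in> I"
      then have "card {a \<in> I. a < i} < card I"
        using assms by (intro psubset_card_mono) auto
      then show "i \<in> pick I ` {..<card I}"
        using pick_card_in_set[OF i] by (intro image_eqI[of _ _ "card {a \<in> I. a < i}"]) auto
    qed
  qed
  then show ?thesis by (intro bij_betw_imageI eq_card_imp_inj_on) auto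
qed

text \<open>With \<open>E\<^sub>I\<close> the selection matrix of \<open>I\<close>, \<open>M[I, J] = E\<^sub>I\<^sup>* M E\<^sub>J\<close>.\<close>

definition selection_mat :: "nat \<Rightarrow> nat set \<Rightarrow> complex mat" where
  "selection_mat n I = mat n (card I) (\<lambda>(i, k). if i = pick I k then 1 else 0)"

lemma selection_mat_carrier [simp]: "selection_mat n I \<in> carrier_mat n (card I)"
  unfolding selection_mat_def by simp

lemma pick_less:
  assumes "I \<subseteq> {..<n}" "k < card I"
  shows "pick I k < n"
  using pick_in_set_le[OF assms(2)] assms(1) by auto

lemma index_mult_selection_mat:
  assumes "M \<in> carrier_mat m n" "I \<subseteq> {..<n}" "i < m" "k < card I"
  shows "(M * selection_mat n I) $$ (i, k) = M $$ (i, pick I k)"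
  using assms pick_less[OF assms(2,4)]
  by (simp add: selection_mat_def scalar_prod_def if_distrib[of "(*) _"] cong: if_cong)

lemma index_selection_mat_adjoint_vec:
  assumes "z \<in> carrier_vec n" "I \<subseteq> {..<n}" "k < card I"
  shows "(mat_adjoint (selection_mat n I) *\<^sub>v z) $ k = z $ pick I k"
  using assms pick_less[OF assms(2,3)]
  by (simp add: selection_mat_def scalar_prod_def if_distrib if_distribR cong: if_cong)

lemma selection_mat_orthonormal:
  assumes I: "I \<subseteq> {..<n}"
  shows "mat_adjoint (selection_mat n I) * selection_mat n I = 1\<^sub>m (card I)"
proof -
  have inj: "inj_on (pick I) {..<card I}"
    using pick_bij_betw finite_subset[OF I] by (auto simp: bij_betw_def)
  have *: "mat_adjoint (selection_mat n I) \<in> carrier_mat (card I) n" by simp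
  show ?thesis
  proof (rule eq_matI)
    fix i k assume "i < dim_row (1\<^sub>m (card I) :: complex mat)" "k < dim_col (1\<^sub>m (card I) :: complex mat)"
    then have ik: "i < card I" "k < card I" by auto
    have "(mat_adjoint (selection_mat n I) * selection_mat n I) $$ (i, k)
        = mat_adjoint (selection_mat n I) $$ (i, pick I k)"
      by (rule index_mult_selection_mat[OF * I ik])
    also have "\<dots> = 1\<^sub>m (card I) $$ (i, k)"
      using ik pick_less[OF I] inj by (auto simp: selection_mat_def inj_on_def)
    finally show "(mat_adjoint (selection_mat n I) * selection_mat n I) $$ (i, k)
      = 1\<^sub>m (card I) $$ (i, k)" .
  qed (auto simp: selection_mat_def)
qed

lemma vec_norm2_selection_mat_adjoint:
  assumes z: "z \<in> carrier_vec n" and I: "I \<subseteq> {..<n}"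
  shows "vec_norm2 (mat_adjoint (selection_mat n I) *\<^sub>v z) = (\<Sum>i\<in>I. (cmod (z $ i))\<^sup>2)"
proof -
  have "vec_norm2 (mat_adjoint (selection_mat n I) *\<^sub>v z) = (\<Sum>k<card I. (cmod (z $ pick I k))\<^sup>2)"
    unfolding vec_norm2_def
    using index_selection_mat_adjoint_vec[OF z I] by (intro sum.cong) (auto simp: selection_mat_def)
  also have "\<dots> = (\<Sum>i\<in>I. (cmod (z $ i))\<^sup>2)"
    by (rule sum.reindex_bij_betw[OF pick_bij_betw]) (rule finite_subset[OF I], simp)
  finally show ?thesis .
qed

lemma Collect_less_Int: "I \<subseteq> {..<n} \<Longrightarrow> {i. i < n \<and> i \<in> I} = I"
  by auto

lemma submatrix_carrier:
  assumes "M \<in> carrier_mat m n" "I \<subseteq> {..<m}" "J \<subseteq> {..<n}"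
  shows "submatrix M I J \<in> carrier_mat (card I) (card J)"
  using assms by (intro carrier_matI) (simp_all add: dim_submatrix Collect_less_Int)

lemma index_submatrix:
  assumes "M \<in> carrier_mat m n" "I \<subseteq> {..<m}" "J \<subseteq> {..<n}" "i < card I" "k < card J"
  shows "submatrix M I J $$ (i, k) = M $$ (pick I i, pick J k)"
  using assms by (simp add: submatrix_index Collect_less_Int)

text \<open>A block acts by extending \<open>v\<close> by zeros, applying \<open>M\<close> and
  restricting, so norm estimates for \<open>M\<close> transfer to its blocks.\<close>

lemma submatrix_mult_vec:
  assumes M: "M \<in> carrier_mat m n" and I: "I \<subseteq> {..<m}" and J: "J \<subseteq> {..<n}"
    and v: "v \<in> carrier_vec (card J)"
  shows "submatrix M I J *\<^sub>v v
    = mat_adjoint (selection_mat m I) *\<^sub>v ((M * selection_mat n J) *\<^sub>v v)"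
proof (rule eq_vecI)
  have c: "(M * selection_mat n J) *\<^sub>v v \<in> carrier_vec m"
    using M by (intro mult_mat_vec_carrier[OF mult_carrier_mat v]) auto
  fix k assume "k < dim_vec (mat_adjoint (selection_mat m I) *\<^sub>v ((M * selection_mat n J) *\<^sub>v v))"
  then have k: "k < card I" by (simp add: selection_mat_def)
  have "(mat_adjoint (selection_mat m I) *\<^sub>v ((M * selection_mat n J) *\<^sub>v v)) $ k
      = ((M * selection_mat n J) *\<^sub>v v) $ pick I k"
    by (rule index_selection_mat_adjoint_vec[OF c I k])
  also have "\<dots> = (\<Sum>l<card J. (M * selection_mat n J) $$ (pick I k, l) * v $ l)"
  proof -
    have "((M * selection_mat n J) *\<^sub>v v) $ pick I k = row (M * selection_mat n J) (pick I k) \<bullet> v"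
      by (rule index_mult_mat_vec) (use M pick_less[OF I k] in simp)
    also have "\<dots> = (\<Sum>l<card J. row (M * selection_mat n J) (pick I k) $ l * v $ l)"
      using v by (simp add: scalar_prod_def lessThan_atLeast0)
    also have "\<dots> = (\<Sum>l<card J. (M * selection_mat n J) $$ (pick I k, l) * v $ l)"
      using M pick_less[OF I k] carrier_matD(2)[OF selection_mat_carrier[of n J]]
      by (intro sum.cong) (simp_all del: index_mult_mat(1))
    finally show ?thesis .
  qed
  also have "\<dots> = (\<Sum>l<card J. submatrix M I J $$ (k, l) * v $ l)"
    by (rule sum.cong)
      (simp_all add: index_mult_selection_mat[OF M J pick_less[OF I k]] index_submatrix[OF M I J k]
        del: index_mult_mat(1))
  also have "\<dots> = (submatrix M I J *\<^sub>v v) $ k"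
    using submatrix_carrier[OF M I J] v k by (simp add: scalar_prod_def lessThan_atLeast0)
  finally show "(submatrix M I J *\<^sub>v v) $ k
    = (mat_adjoint (selection_mat m I) *\<^sub>v ((M * selection_mat n J) *\<^sub>v v)) $ k" by simp
qed (use submatrix_carrier[OF M I J] in \<open>auto simp: selection_mat_def\<close>)

lemma submatrix_one:
  assumes I: "I \<subseteq> {..<n}"
  shows "submatrix (1\<^sub>m n) I I = (1\<^sub>m (card I) :: complex mat)"
proof -
  have inj: "inj_on (pick I) {..<card I}"
    using pick_bij_betw finite_subset[OF I] by (auto simp: bij_betw_def)
  have one: "(1\<^sub>m n :: complex mat) \<in> carrier_mat n n" by simp
  show ?thesis
    using submatrix_carrier[OF one I I] index_submatrix[OF one I I] pick_less[OF I] inj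
    by (intro eq_matI) (auto simp: inj_on_def)
qed

text \<open>This turns the product of two opposite blocks of a Hermitian matrix into a Gram
  matrix.\<close>

lemma submatrix_hermitian:
  assumes M: "M \<in> carrier_mat n n" "hermitian_mat M" and I: "I \<subseteq> {..<n}" and J: "J \<subseteq> {..<n}"
  shows "submatrix M I J = mat_adjoint (submatrix M J I)"
proof (rule eq_matI)
  note IJ = submatrix_carrier[OF M(1) I J] and JI = submatrix_carrier[OF M(1) J I]
  fix i j assume "i < dim_row (mat_adjoint (submatrix M J I))" "j < dim_col (mat_adjoint (submatrix M J I))"
  then have ij: "i < card I" "j < card J" using JI by auto
  have "M $$ (pick I i, pick J j) = cnj (M $$ (pick J j, pick I i))"
    by (rule hermitian_matD[OF M(2)]) (use M(1) pick_less[OF I ij(1)] pick_less[OF J ij(2)] in auto)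
  then show "submatrix M I J $$ (i, j) = mat_adjoint (submatrix M J I) $$ (i, j)"
    using ij JI by (simp add: index_submatrix[OF M(1) I J] index_submatrix[OF M(1) J I])
qed (use submatrix_carrier[OF M(1) I J] submatrix_carrier[OF M(1) J I] in auto)

text \<open>The quadratic form of the difference at \<open>v\<close> is
  \<open>vec_norm2 (Q *\<^sub>v v) - c * vec_norm2 v\<close>, and both matrices are Hermitian by
  construction.\<close>

lemma hermitian_greater_gram_iff:
  assumes Q: "Q \<in> carrier_mat m m"
  shows "hermitian_greater (mat_adjoint Q * Q) (complex_of_real c \<cdot>\<^sub>m 1\<^sub>m m) \<longleftrightarrow>
    (\<forall>v\<in>carrier_vec m. v \<noteq> 0\<^sub>v m \<longrightarrow> c * vec_norm2 v < vec_norm2 (Q *\<^sub>v v))"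
proof -
  note Q' = mat_adjoint_carrier[OF Q]
  let ?X = "mat_adjoint Q * Q" and ?Y = "complex_of_real c \<cdot>\<^sub>m 1\<^sub>m m"
  have X: "?X \<in> carrier_mat m m" and Y: "?Y \<in> carrier_mat m m" using Q Q' by auto
  have hX: "hermitian_mat ?X"
    using Q Q' X by (simp add: hermitian_mat_def mat_adjoint_mult[OF Q' Q])
  have hY: "hermitian_mat ?Y"
    unfolding hermitian_mat_def by auto
  have hXY: "hermitian_mat (?X - ?Y)"
    unfolding hermitian_mat_def
  proof (intro conjI eq_matI)
    fix i j assume "i < dim_row (?X - ?Y)" "j < dim_col (?X - ?Y)"
    then have ij: "i < m" "j < m" by auto
    then show "mat_adjoint (?X - ?Y) $$ (i, j) = (?X - ?Y) $$ (i, j)"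
      using hermitian_matD[OF hX, of j i] hermitian_matD[OF hY, of j i] Q X Y
      by (simp del: index_mult_mat(1) index_smult_mat(1))
  qed (use Q in auto)
  have form: "((?X - ?Y) *\<^sub>v v) \<bullet>c v = complex_of_real (vec_norm2 (Q *\<^sub>v v) - c * vec_norm2 v)"
    if v: "v \<in> carrier_vec m" for v
  proof -
    have Qv: "Q *\<^sub>v v \<in> carrier_vec m" using Q v by auto
    have "?X *\<^sub>v v = mat_adjoint Q *\<^sub>v (Q *\<^sub>v v)"
      using Q Q' v by (simp add: assoc_mult_mat_vec[of _ m m _ m])
    then have "(?X *\<^sub>v v) \<bullet>c v = complex_of_real (vec_norm2 (Q *\<^sub>v v))"
      using cscalar_prod_adjoint[OF Q' Qv v] by (simp add: cscalar_prod_self)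
    moreover have "?Y *\<^sub>v v = complex_of_real c \<cdot>\<^sub>v v"
    proof (rule eq_vecI)
      fix i assume "i < dim_vec (complex_of_real c \<cdot>\<^sub>v v)"
      then have i: "i < m" using v by simp
      have "(?Y *\<^sub>v v) $ i = (\<Sum>k = 0..<m. complex_of_real c * (if k = i then 1 else 0) * v $ k)"
        using v i by (simp add: scalar_prod_def)
      also have "\<dots> = (\<Sum>k = 0..<m. if k = i then complex_of_real c * v $ k else 0)"
        by (rule sum.cong) auto
      also have "\<dots> = (complex_of_real c \<cdot>\<^sub>v v) $ i" using v i by simp
      finally show "(?Y *\<^sub>v v) $ i = (complex_of_real c \<cdot>\<^sub>v v) $ i" .
    qed (use v in simp)
    moreover have "(?X - ?Y) *\<^sub>v v = ?X *\<^sub>v v - ?Y *\<^sub>v v"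
      using X Y v by (rule minus_mult_distrib_mat_vec)
    moreover have "?X *\<^sub>v v \<in> carrier_vec m" using mult_mat_vec_carrier[OF X v] .
    ultimately show ?thesis
      using v by (simp add: minus_scalar_prod_distrib[of _ m] cscalar_prod_self del: assoc_mult_mat_vec)
  qed
  show ?thesis
    unfolding hermitian_greater_def positive_definite_def using hX hY hXY form Q X
    by auto
qed

text \<open>Fewer than \<open>m\<close> homogeneous linear equations in \<open>m\<close> unknowns
  have a nonzero solution.\<close>

lemma exists_kernel_vector:
  fixes Z :: "complex mat"
  assumes Z: "Z \<in> carrier_mat n m" and S: "S \<subseteq> {..<n}" and less: "card S < m"
  obtains v where "v \<in> carrier_vec m" "v \<noteq> 0\<^sub>v m" "\<forall>i\<in>S. (Z *\<^sub>v v) $ i = 0"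
proof -
  \<comment> \<open>The equations are padded to a square matrix. Row \<open>card S\<close> exists
    because \<open>card S < m\<close>, and being zero it makes the determinant vanish; only the rows
    before it are used afterwards.\<close>
  define M where "M = mat\<^sub>r m m (\<lambda>r. if r = card S then 0\<^sub>v m else row Z (pick S r))"
  have M: "M \<in> carrier_mat m m" by (simp add: M_def)
  have "det M = 0" unfolding M_def by (rule det_row_0[OF less]) (use Z in auto)
  then obtain v where v: "v \<in> carrier_vec m" "v \<noteq> 0\<^sub>v m" "M *\<^sub>v v = 0\<^sub>v m"
    using det_0_iff_vec_prod_zero[OF M] by auto
  have zero: "(Z *\<^sub>v v) $ i = 0" if "i \<in> S" for i
  proof -
    have "i \<in> pick S ` {..<card S}"
      using bij_betw_imp_surj_on[OF pick_bij_betw[OF finite_subset[OF S finite_lessThan]]] that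
      by blast
    then obtain r where r: "r < card S" "i = pick S r" by blast
    have "(Z *\<^sub>v v) $ i = row Z i \<bullet> v"
      by (rule index_mult_mat_vec) (use \<open>i \<in> S\<close> S Z in auto)
    also have "row Z i = row M r"
      using r less Z by (intro eq_vecI) (auto simp: M_def)
    also have "row M r \<bullet> v = (M *\<^sub>v v) $ r"
      by (rule index_mult_mat_vec[symmetric]) (use r(1) less M in simp)
    also have "\<dots> = 0" unfolding v(3) using r(1) less by simp
    finally show ?thesis .
  qed
  show ?thesis using zero by (intro that[OF v(1,2)] ballI)
qed

subsection \<open>Blocks of the inverse\<close>

text \<open>Invertibility places \<open>A\<close> in the unit group, which excludes the result
  \<open>None\<close>; hence \<open>the\<close> in \<open>mat_inv\<close> is applied to an actual
  inverse.\<close>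

lemma mat_inv_props:
  assumes A: "A \<in> carrier_mat n n" and inv: "invertible_mat A"
  shows "mat_inv A \<in> carrier_mat n n" "A * mat_inv A = 1\<^sub>m n"
proof -
  obtain B where B: "inverts_mat A B" "inverts_mat B A"
    using inv unfolding invertible_mat_def by blast
  then have AB: "A * B = 1\<^sub>m n" using A by (simp add: inverts_mat_def)
  have "B \<in> carrier_mat n n"
  proof
    show "dim_row B = n" using B(2) A by (metis carrier_matD(2) index_mult_mat(3) index_one_mat(3) inverts_mat_def)
    show "dim_col B = n" using AB by (metis index_mult_mat(3) index_one_mat(3))
  qed
  with AB have "A \<in> Units (ring_mat TYPE(complex) n ())"
    using A mat_mult_left_right_inverse[OF A _ AB] unfolding Units_def by (auto simp: ring_mat_def)
  then obtain C where "mat_inverse A = Some C"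
    using mat_inverse(1)[OF A, where b = "()"] by (cases "mat_inverse A") auto
  then show "mat_inv A \<in> carrier_mat n n" "A * mat_inv A = 1\<^sub>m n"
    using mat_inverse(2)[OF A, of C] by (auto simp: mat_inv_def)
qed

text \<open>The adjoint of a right inverse of \<open>A\<close> is a left inverse of
  \<open>A\<close>, and left and right inverses agree.\<close>

lemma hermitian_mat_inv:
  assumes A: "A \<in> carrier_mat n n" "hermitian_mat A" "invertible_mat A"
  shows "hermitian_mat (mat_inv A)"
proof -
  note B = mat_inv_props[OF A(1,3)]
  note B' = mat_adjoint_carrier[OF B(1)]
  have "mat_adjoint (mat_inv A) * A = mat_adjoint (A * mat_inv A)"
    using A by (simp add: mat_adjoint_mult[OF A(1) B(1)] hermitian_mat_def)
  then have *: "mat_adjoint (mat_inv A) * A = 1\<^sub>m n" by (simp add: B(2))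
  have "mat_adjoint (mat_inv A) = mat_adjoint (mat_inv A) * (A * mat_inv A)"
    unfolding B(2) right_mult_one_mat[OF B'] ..
  also have "\<dots> = mat_adjoint (mat_inv A) * A * mat_inv A"
    by (rule assoc_mult_mat[OF B' A(1) B(1), symmetric])
  finally have "mat_adjoint (mat_inv A) = mat_inv A"
    unfolding * left_mult_one_mat[OF B(1)] .
  then show ?thesis using B(1) by (simp add: hermitian_mat_def)
qed

text \<open>The block product is the Gram matrix of the block with rows \<beta> and columns
  \<alpha>. Both implications use the condition in this form, as an expansion bound for vectors
  supported on \<alpha>.\<close>

lemma large_inverse_block_iff:
  assumes A: "A \<in> carrier_mat N N" "hermitian_mat A" "invertible_mat A"
  shows "large_inverse_block N m \<epsilon> K A \<longleftrightarrow>
    (\<exists>\<alpha> \<beta>. \<alpha> \<subseteq> {..<N} \<and> \<beta> \<subseteq> {..<N} \<and> card \<alpha> = m \<and> card \<beta> = m \<and>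
      (\<forall>v\<in>carrier_vec m. v \<noteq> 0\<^sub>v m \<longrightarrow> K\<^sup>2 / \<epsilon>\<^sup>2 * vec_norm2 v
        < (\<Sum>j\<in>\<beta>. (cmod (((mat_inv A * selection_mat N \<alpha>) *\<^sub>v v) $ j))\<^sup>2)))"
proof -
  note B = mat_inv_props(1)[OF A(1,3)] and hB = hermitian_mat_inv[OF A]
  have key: "hermitian_greater (submatrix (mat_inv A) \<alpha> \<beta> * submatrix (mat_inv A) \<beta> \<alpha>)
          (complex_of_real (K\<^sup>2 / \<epsilon>\<^sup>2) \<cdot>\<^sub>m submatrix (1\<^sub>m N) \<alpha> \<alpha>) \<longleftrightarrow>
      (\<forall>v\<in>carrier_vec m. v \<noteq> 0\<^sub>v m \<longrightarrow> K\<^sup>2 / \<epsilon>\<^sup>2 * vec_norm2 v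
        < (\<Sum>j\<in>\<beta>. (cmod (((mat_inv A * selection_mat N \<alpha>) *\<^sub>v v) $ j))\<^sup>2))"
    if \<alpha>: "\<alpha> \<subseteq> {..<N}" "card \<alpha> = m" and \<beta>: "\<beta> \<subseteq> {..<N}" "card \<beta> = m" for \<alpha> \<beta>
  proof -
    have norm: "vec_norm2 (submatrix (mat_inv A) \<beta> \<alpha> *\<^sub>v v)
        = (\<Sum>j\<in>\<beta>. (cmod (((mat_inv A * selection_mat N \<alpha>) *\<^sub>v v) $ j))\<^sup>2)"
      if v: "v \<in> carrier_vec m" for v
    proof -
      have "(mat_inv A * selection_mat N \<alpha>) *\<^sub>v v \<in> carrier_vec N"
        using B selection_mat_carrier[of N \<alpha>] \<alpha>(2) v
        by (intro mult_mat_vec_carrier[OF mult_carrier_mat]) auto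
      then show ?thesis
        using submatrix_mult_vec[OF B \<beta>(1) \<alpha>(1)] v \<alpha>(2)
        by (simp add: vec_norm2_selection_mat_adjoint[OF _ \<beta>(1)])
    qed
    show ?thesis
      unfolding submatrix_hermitian[OF B hB \<alpha>(1) \<beta>(1)] submatrix_one[OF \<alpha>(1)] \<alpha>(2)
      using hermitian_greater_gram_iff[of "submatrix (mat_inv A) \<beta> \<alpha>" m "K\<^sup>2 / \<epsilon>\<^sup>2"]
        submatrix_carrier[OF B \<beta>(1) \<alpha>(1)] \<alpha>(2) \<beta>(2) norm by simp
  qed
  show ?thesis
    unfolding large_inverse_block_def by (intro ex_cong1 conj_cong refl key)
qed

section \<open>The inverse in eigenvector coordinates\<close>

lemma real_diag_mult_vec:
  assumes "z \<in> carrier_vec n" "i < n"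
  shows "(real_diag n d *\<^sub>v z) $ i = complex_of_real (d i) * z $ i"
proof -
  have "(real_diag n d *\<^sub>v z) $ i = (\<Sum>k = 0..<n. (if i = k then complex_of_real (d i) else 0) * z $ k)"
    using assms by (simp add: real_diag_def scalar_prod_def)
  also have "\<dots> = (\<Sum>k = 0..<n. if k = i then complex_of_real (d i) * z $ k else 0)"
    by (rule sum.cong) auto
  also have "\<dots> = complex_of_real (d i) * z $ i" using assms by simp
  finally show ?thesis .
qed

text \<open>Inserting \<open>A * B\<close> and \<open>U * mat_adjoint U\<close>, both the identity,
  gives \<open>mat_adjoint U = real_diag n d * (mat_adjoint U * B)\<close>. Multiplying by
  \<open>d i\<close> instead of dividing avoids showing that the eigenvalues are nonzero.\<close>

lemma inverse_spectral_coordinates: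
  assumes A: "A \<in> carrier_mat n n" and B: "B \<in> carrier_mat n n" "A * B = 1\<^sub>m n"
    and U: "U \<in> carrier_mat n n" "mat_adjoint U * U = 1\<^sub>m n"
    and D: "mat_adjoint U * A * U = real_diag n d"
    and x: "x \<in> carrier_vec n" and i: "i < n"
  shows "(mat_adjoint U *\<^sub>v x) $ i = complex_of_real (d i) * (mat_adjoint U *\<^sub>v (B *\<^sub>v x)) $ i"
proof -
  note U' = mat_adjoint_carrier[OF U(1)]
  have UU: "U * mat_adjoint U = 1\<^sub>m n" by (rule mat_mult_left_right_inverse[OF U' U])
  have U'A: "mat_adjoint U * A \<in> carrier_mat n n" by (rule mult_carrier_mat[OF U' A])
  have "mat_adjoint U = mat_adjoint U * A * (U * mat_adjoint U) * B"
    unfolding UU right_mult_one_mat[OF U'A] assoc_mult_mat[OF U' A B(1)] B(2)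
      right_mult_one_mat[OF U'] ..
  also have "\<dots> = real_diag n d * (mat_adjoint U * B)"
    unfolding D[symmetric] assoc_mult_mat[OF U'A U(1) U', symmetric]
    by (rule assoc_mult_mat[OF mult_carrier_mat[OF U'A U(1)] U' B(1)])
  finally have "mat_adjoint U *\<^sub>v x = real_diag n d *\<^sub>v (mat_adjoint U *\<^sub>v (B *\<^sub>v x))"
    using A B U' x by (metis assoc_mult_mat_vec mult_carrier_mat real_diag_carrier)
  moreover have "mat_adjoint U *\<^sub>v (B *\<^sub>v x) \<in> carrier_vec n"
    by (intro mult_mat_vec_carrier[OF U'] mult_mat_vec_carrier[OF B(1)] x)
  ultimately show ?thesis using i by (simp only: real_diag_mult_vec)
qed

text \<open>From \<open>m \<le> fact m\<close> and \<open>1 \<le> 2 ^ (m - 1)\<close>. It passes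
  from the constant that the two row selections yield to the smaller one claimed.\<close>

lemma block_const_le:
  assumes "1 \<le> m" "m \<le> N"
  shows "0 \<le> block_const m / real N" "block_const m / real N \<le> 1 / (real m * real N)"
proof -
  have "real m \<le> real (fact m)" using fact_ge_self[of m] by (rule of_nat_mono)
  then have "real m * 1 \<le> fact m * 2 ^ (m - 1)" by (intro mult_mono) simp_all
  then show "block_const m / real N \<le> 1 / (real m * real N)"
    using assms by (simp add: block_const_def field_simps)
  show "0 \<le> block_const m / real N" by (simp add: block_const_def)
qed

section \<open>Small eigenvalues against large blocks of the inverse\<close>

theorem theorem1p1:
  fixes A :: "complex mat" and N m :: nat and \<epsilon> :: real
  assumes "A \<in> carrier_mat N N"
    and "hermitian_mat A"
    and "invertible_mat A"
    and "1 \<le> m" and "m \<le> N"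
    and "\<epsilon> > 0"
  shows "(eig_count \<epsilon> A \<ge> m \<longrightarrow> large_inverse_block N m \<epsilon> (block_const m / real N) A) \<and>
         (large_inverse_block N m \<epsilon> 1 A \<longrightarrow> eig_count \<epsilon> A \<ge> m)"
proof (intro conjI impI)
  note A = assms(1-3) and m = assms(4,5) and \<epsilon> = assms(6)
  define B where "B = mat_inv A"
  have B: "B \<in> carrier_mat N N" "A * B = 1\<^sub>m N" using mat_inv_props[OF A(1,3)] by (auto simp: B_def)
  obtain U d where U: "U \<in> carrier_mat N N" "mat_adjoint U * U = 1\<^sub>m N"
    and D: "mat_adjoint U * A * U = real_diag N d"
    using hermitian_unitary_diagonalization[OF A(1,2)] by blast
  note U' = mat_adjoint_carrier[OF U(1)]
  have UU: "mat_adjoint (mat_adjoint U) * mat_adjoint U = 1\<^sub>m N"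
    using mat_mult_left_right_inverse[OF U' U] by simp
  define S where "S = {i. i < N \<and> \<bar>d i\<bar> < \<epsilon>}"
  have count: "eig_count \<epsilon> A = card S"
    unfolding S_def by (rule eig_count_diagonalization[OF A(1) U D])
  \<comment> \<open>The coordinates of \<open>B *\<^sub>v x\<close> in the eigenbasis; those of
    \<open>x\<close> itself are \<open>d i\<close> times as large.\<close>
  define y where "y = (\<lambda>x i. (mat_adjoint U *\<^sub>v (B *\<^sub>v x)) $ i)"
  have Bx: "vec_norm2 (B *\<^sub>v x) = (\<Sum>i<N. (cmod (y x i))\<^sup>2)" if x: "x \<in> carrier_vec N" for x
    using vec_norm2_isometry[OF U' UU mult_mat_vec_carrier[OF B(1) x]] U
    unfolding vec_norm2_def[of "mat_adjoint U *\<^sub>v (B *\<^sub>v x)"] y_def dim_mult_mat_vec by simp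
  have coord: "(cmod ((mat_adjoint U *\<^sub>v x) $ i))\<^sup>2 = (d i)\<^sup>2 * (cmod (y x i))\<^sup>2"
    if "x \<in> carrier_vec N" "i < N" for x i
    unfolding y_def inverse_spectral_coordinates[OF A(1) B U D that]
    by (simp add: norm_mult power_mult_distrib)
  {
    assume "eig_count \<epsilon> A \<ge> m"
    then obtain T where T: "T \<subseteq> S" "card T = m"
      using obtain_subset_with_card_n[of m S] count by metis
    then have TN: "T \<subseteq> {..<N}" by (auto simp: S_def)
    have J: "selection_mat N T \<in> carrier_mat N m" using selection_mat_carrier[of N T] T by simp
    note J' = mat_adjoint_carrier[OF J]
    \<comment> \<open>The columns of \<open>V\<close> are orthonormal eigenvectors for
      \<open>m\<close> of the small eigenvalues.\<close>
    define V where "V = U * selection_mat N T"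
    have V: "V \<in> carrier_mat N m" using U J by (auto simp: V_def)
    have V': "mat_adjoint V = mat_adjoint (selection_mat N T) * mat_adjoint U"
      unfolding V_def by (rule mat_adjoint_mult[OF U(1) J])
    have normV: "vec_norm2 (V *\<^sub>v w) = vec_norm2 w" if w: "w \<in> carrier_vec m" for w
      unfolding V_def assoc_mult_mat_vec[OF U(1) J w]
        vec_norm2_isometry[OF U mult_mat_vec_carrier[OF J w]]
      by (rule vec_norm2_isometry[OF J _ w]) (use selection_mat_orthonormal[OF TN] T(2) in simp)
    have "V *\<^sub>v w \<noteq> 0\<^sub>v N" if "w \<in> carrier_vec m" "w \<noteq> 0\<^sub>v m" for w
      using normV[OF that(1)] vec_norm2_pos[OF that] by auto
    from dominant_rows[OF V this]
    obtain \<alpha> where \<alpha>: "\<alpha> \<subseteq> {..<N}" "card \<alpha> = m"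
      and V\<alpha>: "\<And>w. w \<in> carrier_vec m \<Longrightarrow>
        vec_norm2 (V *\<^sub>v w) \<le> real m * real N * (\<Sum>j\<in>\<alpha>. (cmod ((V *\<^sub>v w) $ j))\<^sup>2)"
      by metis
    define E where "E = selection_mat N \<alpha>"
    have E: "E \<in> carrier_mat N m" using selection_mat_carrier[of N \<alpha>] \<alpha> by (simp add: E_def)
    note E' = mat_adjoint_carrier[OF E]
    \<comment> \<open>\<open>c\<close> refers to squared norms: each of the two row selections costs
      the factor \<open>m * N\<close> there. Together they give \<open>c\<^sup>2\<close>, so
      \<open>c\<close> itself is the value of \<open>K\<close> obtained.\<close>
    define c where "c = 1 / (real m * real N)"
    have c: "c > 0" using m by (simp add: c_def)
    have M: "mat_adjoint E * V \<in> carrier_mat m m" using E' V by auto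
    have lower: "c * vec_norm2 w \<le> vec_norm2 ((mat_adjoint E * V) *\<^sub>v w)"
      if w: "w \<in> carrier_vec m" for w
    proof -
      have "vec_norm2 ((mat_adjoint E * V) *\<^sub>v w) = (\<Sum>j\<in>\<alpha>. (cmod ((V *\<^sub>v w) $ j))\<^sup>2)"
        unfolding assoc_mult_mat_vec[OF E' V w] unfolding E_def
        by (rule vec_norm2_selection_mat_adjoint[OF mult_mat_vec_carrier[OF V w] \<alpha>(1)])
      then show ?thesis using V\<alpha>[OF w] normV[OF w] m by (simp add: c_def field_simps)
    qed
    define G where "G = B * E"
    have G: "G \<in> carrier_mat N m" using B E by (auto simp: G_def)
    have Glow: "c / \<epsilon>\<^sup>2 * vec_norm2 v < vec_norm2 (G *\<^sub>v v)"
      if v: "v \<in> carrier_vec m" "v \<noteq> 0\<^sub>v m" for v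
    proof -
      define x where "x = E *\<^sub>v v"
      have x: "x \<in> carrier_vec N" unfolding x_def by (rule mult_mat_vec_carrier[OF E v(1)])
      \<comment> \<open>The adjoint of \<open>mat_adjoint E * V\<close> sends \<open>v\<close> to
        the coordinates of \<open>x\<close> along the eigenvectors in \<open>T\<close>.
        \<open>adjoint_lower_bound\<close> carries the bound \<open>lower\<close> over to
        it.\<close>
      have "mat_adjoint (mat_adjoint E * V) = mat_adjoint V * E"
        using mat_adjoint_mult[OF E' V] by simp
      then have "mat_adjoint (mat_adjoint E * V) *\<^sub>v v = mat_adjoint V *\<^sub>v x"
        using assoc_mult_mat_vec[OF mat_adjoint_carrier[OF V] E v(1)] by (simp add: x_def)
      also have "\<dots> = mat_adjoint (selection_mat N T) *\<^sub>v (mat_adjoint U *\<^sub>v x)"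
        unfolding V' by (rule assoc_mult_mat_vec[OF J' U' x])
      finally have "c * vec_norm2 v \<le> (\<Sum>i\<in>T. (cmod ((mat_adjoint U *\<^sub>v x) $ i))\<^sup>2)"
        using adjoint_lower_bound[OF M c lower v(1)]
          vec_norm2_selection_mat_adjoint[OF mult_mat_vec_carrier[OF U' x] TN] by simp
      also have "\<dots> = (\<Sum>i\<in>T. (d i)\<^sup>2 * (cmod (y x i))\<^sup>2)"
        by (rule sum.cong) (use coord[OF x] TN in auto)
      finally have le: "c * vec_norm2 v \<le> (\<Sum>i\<in>T. (d i)\<^sup>2 * (cmod (y x i))\<^sup>2)" .
      have d: "(d i)\<^sup>2 < \<epsilon>\<^sup>2" if "i \<in> T" for i
        using that T(1) \<epsilon> power_strict_mono[of "\<bar>d i\<bar>" \<epsilon> 2] by (auto simp: S_def)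
      \<comment> \<open>The sum is positive, so some term is nonzero; at that index the strict bound
        on \<open>d i\<close> survives multiplication by the squared coordinate.\<close>
      have "(\<Sum>i\<in>T. (d i)\<^sup>2 * (cmod (y x i))\<^sup>2) \<noteq> 0"
        using le mult_pos_pos[OF c vec_norm2_pos[OF v]] by linarith
      then obtain i where i: "i \<in> T" "(d i)\<^sup>2 * (cmod (y x i))\<^sup>2 \<noteq> 0"
        by (rule sum.not_neutral_contains_not_neutral)
      have "finite T" using TN by (rule finite_subset) simp
      then have "(\<Sum>i\<in>T. (d i)\<^sup>2 * (cmod (y x i))\<^sup>2) < (\<Sum>i\<in>T. \<epsilon>\<^sup>2 * (cmod (y x i))\<^sup>2)"
      proof (rule sum_strict_mono_ex1)
        show "\<forall>i\<in>T. (d i)\<^sup>2 * (cmod (y x i))\<^sup>2 \<le> \<epsilon>\<^sup>2 * (cmod (y x i))\<^sup>2"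
          by (intro ballI mult_right_mono less_imp_le[OF d] zero_le_power2)
        show "\<exists>i\<in>T. (d i)\<^sup>2 * (cmod (y x i))\<^sup>2 < \<epsilon>\<^sup>2 * (cmod (y x i))\<^sup>2"
          using i d[OF i(1)] by (intro bexI[of _ i] mult_strict_right_mono) auto
      qed
      also have "\<dots> \<le> \<epsilon>\<^sup>2 * vec_norm2 (B *\<^sub>v x)"
        unfolding Bx[OF x] sum_distrib_left[symmetric]
        by (intro mult_left_mono sum_mono2) (use TN in auto)
      finally have "c * vec_norm2 v < \<epsilon>\<^sup>2 * vec_norm2 (B *\<^sub>v x)" using le by simp
      moreover have "G *\<^sub>v v = B *\<^sub>v x"
        unfolding G_def x_def by (rule assoc_mult_mat_vec[OF B(1) E v(1)])
      ultimately show ?thesis using \<epsilon> by (simp add: field_simps)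
    qed
    have "G *\<^sub>v v \<noteq> 0\<^sub>v N" if "v \<in> carrier_vec m" "v \<noteq> 0\<^sub>v m" for v
    proof -
      have "0 < c / \<epsilon>\<^sup>2 * vec_norm2 v" using c \<epsilon> vec_norm2_pos[OF that] by simp
      then have "0 < vec_norm2 (G *\<^sub>v v)" using Glow[OF that] by (rule less_trans)
      then show ?thesis by auto
    qed
    \<comment> \<open>The second selection: among the rows of \<open>G\<close>, at the same cost as
      the first.\<close>
    from dominant_rows[OF G this]
    obtain \<beta> where \<beta>: "\<beta> \<subseteq> {..<N}" "card \<beta> = m"
      and G\<beta>: "\<And>w. w \<in> carrier_vec m \<Longrightarrow>
        vec_norm2 (G *\<^sub>v w) \<le> real m * real N * (\<Sum>j\<in>\<beta>. (cmod ((G *\<^sub>v w) $ j))\<^sup>2)"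
      by metis
    have "(block_const m / real N)\<^sup>2 / \<epsilon>\<^sup>2 * vec_norm2 v < (\<Sum>j\<in>\<beta>. (cmod ((G *\<^sub>v v) $ j))\<^sup>2)"
      if v: "v \<in> carrier_vec m" "v \<noteq> 0\<^sub>v m" for v
    proof -
      have "(block_const m / real N)\<^sup>2 \<le> c\<^sup>2"
        unfolding c_def using block_const_le[OF m] by (intro power_mono)
      then have "(block_const m / real N)\<^sup>2 / \<epsilon>\<^sup>2 * vec_norm2 v \<le> c\<^sup>2 / \<epsilon>\<^sup>2 * vec_norm2 v"
        by (intro mult_right_mono divide_right_mono) auto
      also have "\<dots> = c * (c / \<epsilon>\<^sup>2 * vec_norm2 v)" by (simp add: power2_eq_square)
      also have "\<dots> < c * vec_norm2 (G *\<^sub>v v)" by (rule mult_strict_left_mono[OF Glow[OF v] c])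
      also have "\<dots> \<le> (\<Sum>j\<in>\<beta>. (cmod ((G *\<^sub>v v) $ j))\<^sup>2)"
        using G\<beta>[OF v(1)] m by (simp add: c_def field_simps)
      finally show ?thesis .
    qed
    then show "large_inverse_block N m \<epsilon> (block_const m / real N) A"
      unfolding large_inverse_block_iff[OF A] using \<alpha> \<beta> unfolding G_def E_def B_def by blast
  next
    assume "large_inverse_block N m \<epsilon> 1 A"
    then obtain \<alpha> \<beta> where \<alpha>: "\<alpha> \<subseteq> {..<N}" "card \<alpha> = m" and \<beta>: "\<beta> \<subseteq> {..<N}"
      and big: "\<And>v. v \<in> carrier_vec m \<Longrightarrow> v \<noteq> 0\<^sub>v m \<Longrightarrow>
        1\<^sup>2 / \<epsilon>\<^sup>2 * vec_norm2 v < (\<Sum>j\<in>\<beta>. (cmod (((B * selection_mat N \<alpha>) *\<^sub>v v) $ j))\<^sup>2)"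
      unfolding large_inverse_block_iff[OF A] B_def[symmetric] by blast
    define E where "E = selection_mat N \<alpha>"
    have E: "E \<in> carrier_mat N m" using selection_mat_carrier[of N \<alpha>] \<alpha> by (simp add: E_def)
    show "eig_count \<epsilon> A \<ge> m"
    proof (rule ccontr)
      assume "\<not> eig_count \<epsilon> A \<ge> m"
      then have less: "card S < m" by (simp add: count)
      have SN: "S \<subseteq> {..<N}" by (auto simp: S_def)
      \<comment> \<open>Asking that \<open>B *\<^sub>v x\<close> be orthogonal to the eigenvectors
        in \<open>S\<close> imposes only \<open>card S < m\<close> conditions on the
        \<open>m\<close> entries of \<open>v\<close>.\<close>
      obtain v where v: "v \<in> carrier_vec m" "v \<noteq> 0\<^sub>v m"
        and zero: "\<forall>i\<in>S. ((mat_adjoint U * (B * E)) *\<^sub>v v) $ i = 0"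
        by (rule exists_kernel_vector[OF mult_carrier_mat[OF U' mult_carrier_mat[OF B(1) E]] SN less])
      define x where "x = E *\<^sub>v v"
      have x: "x \<in> carrier_vec N" unfolding x_def by (rule mult_mat_vec_carrier[OF E v(1)])
      have BE: "(B * E) *\<^sub>v v = B *\<^sub>v x"
        unfolding x_def by (rule assoc_mult_mat_vec[OF B(1) E v(1)])
      have "(mat_adjoint U * (B * E)) *\<^sub>v v = mat_adjoint U *\<^sub>v (B *\<^sub>v x)"
        unfolding BE[symmetric] by (rule assoc_mult_mat_vec[OF U' mult_carrier_mat[OF B(1) E] v(1)])
      then have y0: "y x i = 0" if "i \<in> S" for i using zero that by (simp add: y_def)
      have "\<epsilon>\<^sup>2 * vec_norm2 (B *\<^sub>v x) = (\<Sum>i<N. \<epsilon>\<^sup>2 * (cmod (y x i))\<^sup>2)"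
        unfolding Bx[OF x] sum_distrib_left ..
      \<comment> \<open>The coordinates in \<open>S\<close> vanish by the choice of
        \<open>v\<close>, and outside \<open>S\<close> the eigenvalue has modulus at least
        \<epsilon>.\<close>
      also have "\<dots> \<le> (\<Sum>i<N. (d i)\<^sup>2 * (cmod (y x i))\<^sup>2)"
      proof (rule sum_mono)
        fix i assume "i \<in> {..<N}"
        then consider "i \<in> S" | "\<epsilon> \<le> \<bar>d i\<bar>" by (force simp: S_def)
        then show "\<epsilon>\<^sup>2 * (cmod (y x i))\<^sup>2 \<le> (d i)\<^sup>2 * (cmod (y x i))\<^sup>2"
        proof cases
          case 2
          then have "\<epsilon>\<^sup>2 \<le> (d i)\<^sup>2" using \<epsilon> power_mono[of \<epsilon> "\<bar>d i\<bar>" 2] by simp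
          then show ?thesis by (intro mult_right_mono) auto
        qed (simp add: y0)
      qed
      also have "\<dots> = (\<Sum>i<N. (cmod ((mat_adjoint U *\<^sub>v x) $ i))\<^sup>2)"
        by (rule sum.cong) (use coord[OF x] in auto)
      also have "\<dots> = vec_norm2 (mat_adjoint U *\<^sub>v x)"
        using U by (simp only: vec_norm2_def dim_mult_mat_vec dim_mat_adjoint carrier_matD)
      also have "\<dots> = vec_norm2 x" by (rule vec_norm2_isometry[OF U' UU x])
      also have "\<dots> = vec_norm2 v"
        unfolding x_def using vec_norm2_isometry[OF E _ v(1)] selection_mat_orthonormal[OF \<alpha>(1)] \<alpha>(2)
        by (simp add: E_def)
      finally have "vec_norm2 (B *\<^sub>v x) \<le> 1 / \<epsilon>\<^sup>2 * vec_norm2 v" using \<epsilon> by (simp add: field_simps)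
      \<comment> \<open>The rows in \<beta> alone would already carry more than the whole squared
        norm of \<open>B *\<^sub>v x\<close>.\<close>
      also have "\<dots> < (\<Sum>j\<in>\<beta>. (cmod ((B *\<^sub>v x) $ j))\<^sup>2)"
        using big[OF v] BE by (simp add: E_def)
      also have "\<dots> \<le> (\<Sum>j<N. (cmod ((B *\<^sub>v x) $ j))\<^sup>2)"
        by (rule sum_mono2) (use \<beta> in auto)
      also have "\<dots> = vec_norm2 (B *\<^sub>v x)"
        using B(1) by (simp only: vec_norm2_def dim_mult_mat_vec carrier_matD)
      finally show False by simp
    qed
  }
qed

end
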